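(* $N(35) \ge 6$; that is, there exist $6$ mutually orthogonal Latin squares of order $35$.
   Context: A Latin square of order $n$ on an $n$-element set $V$ is an $n\times n$ matrix every row and every column of which is a permutation of $V$. Two Latin squares $L_1=(v_{ij})$ and $L_2=(w_{ij})$ of order $n$ (on symbol sets $V$, $W$ of size $n$) are orthogonal if the $n^2$ pairs $(v_{ij},w_{ij})$ are all distinct, i.e. they exhaust $V\times W$. A set of Latin squares is a set of mutually orthogonal Latin squares (MOLS) if any two of them are orthogonal. $N(n)$ denotes the largest size of a set of MOLS of order $n$. *)

theory Defs
  imports "Jordan_Normal_Form.Matrix"
begin

definition latin_square :: "nat \<Rightarrow> 'a set \<Rightarrow> 'a mat \<Rightarrow> bool" where
  "latin_square n V L \<longleftrightarrow>
     finite V \<and> card V = n \<and> L \<in> carrier_mat n n \<and>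
     (\<forall>i<n. bij_betw (\<lambda>j. L $$ (i, j)) {..<n} V) \<and>
     (\<forall>j<n. bij_betw (\<lambda>i. L $$ (i, j)) {..<n} V)"

definition orthogonal_squares :: "nat \<Rightarrow> 'a mat \<Rightarrow> 'b mat \<Rightarrow> bool" where
  "orthogonal_squares n L M \<longleftrightarrow>
     inj_on (\<lambda>(i, j). (L $$ (i, j), M $$ (i, j))) ({..<n} \<times> {..<n})"

text \<open>Each square of the family may have its own symbol set.\<close>

definition mols :: "nat \<Rightarrow> 'a mat set \<Rightarrow> bool" where
  "mols n S \<longleftrightarrow>
     (\<forall>L\<in>S. \<exists>V. latin_square n V L) \<and> pairwise (orthogonal_squares n) S"

text \<open>Natural numbers as symbols are no restriction, since the symbol sets are finite.
  The maximum is meaningful for \<open>n \<noteq> 1\<close>; for \<open>n = 1\<close> families of every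
  finite size exist.\<close>

definition max_mols :: "nat \<Rightarrow> nat" where
  "max_mols n = Max {card S | S :: nat mat set. finite S \<and> mols n S}"

lemma orthogonal_squares_exhaust:
  assumes "latin_square n V L" "latin_square n W M"
  shows "orthogonal_squares n L M \<longleftrightarrow>
    (\<lambda>(i, j). (L $$ (i, j), M $$ (i, j))) ` ({..<n} \<times> {..<n}) = V \<times> W"
    (is "_ \<longleftrightarrow> ?f ` ?I = _")
proof
  have sub: "?f ` ?I \<subseteq> V \<times> W"
    using assms unfolding latin_square_def bij_betw_def by auto
  have fin: "finite (V \<times> W)" and card: "card (V \<times> W) = card ?I"
    using assms unfolding latin_square_def by (auto simp: card_cartesian_product)
  show "?f ` ?I = V \<times> W" if "orthogonal_squares n L M"
    by (rule card_subset_eq[OF fin sub])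
       (simp only: card card_image[OF that[unfolded orthogonal_squares_def]])
  show "orthogonal_squares n L M" if "?f ` ?I = V \<times> W"
    unfolding orthogonal_squares_def
    by (rule eq_card_imp_inj_on) (simp_all only: that card finite_cartesian_product finite_lessThan)
qed

lemma card_mols_le:
  assumes "mols n S" "n \<ge> 2"
  shows "card S \<le> n - 1"
proof -
  have ex: "\<exists>j. j \<in> {1..<n} \<and> L $$ (1, j) = L $$ (0, 0)" if L: "L \<in> S" for L
  proof -
    obtain V where V: "latin_square n V L"
      using bspec[OF conjunct1[OF assms(1)[unfolded mols_def]] L] by (elim exE)
    have n: "0 < n" "1 < n" using assms(2) by simp_all
    have row: "\<And>i. i < n \<Longrightarrow> bij_betw (\<lambda>j. L $$ (i, j)) {..<n} V"
      and col: "\<And>j. j < n \<Longrightarrow> bij_betw (\<lambda>i. L $$ (i, j)) {..<n} V"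
      using V unfolding latin_square_def by iprover+
    note r0 = row[OF n(1)] and r1 = row[OF n(2)] and c0 = col[OF n(1)]
    have "L $$ (0, 0) \<in> V" using bij_betwE[OF r0] assms(2) by simp
    then have "L $$ (0, 0) \<in> (\<lambda>j. L $$ (1, j)) ` {..<n}"
      using bij_betw_imp_surj_on[OF r1] by simp
    then obtain j where j: "j < n" "L $$ (1, j) = L $$ (0, 0)"
      by (elim imageE) simp
    have "j \<noteq> 0"
    proof
      assume "j = 0"
      then have "(1::nat) = 0"
        using inj_onD[OF bij_betw_imp_inj_on[OF c0], of 1 0] j assms(2) by simp
      then show False by simp
    qed
    then show ?thesis using j by (intro exI[of _ j]) auto
  qed
  then have "\<forall>L\<in>S. \<exists>j. j \<in> {1..<n} \<and> L $$ (1, j) = L $$ (0, 0)" by (rule ballI)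
  then obtain g where "\<forall>L\<in>S. g L \<in> {1..<n} \<and> L $$ (1, g L) = L $$ (0, 0)"
    by (rule bchoice[THEN exE])
  then have g: "\<And>L. L \<in> S \<Longrightarrow> g L \<in> {1..<n} \<and> L $$ (1, g L) = L $$ (0, 0)"
    by (rule bspec)
  have "inj_on g S"
  proof (rule inj_onI, rule ccontr)
    fix L M assume LM: "L \<in> S" "M \<in> S" "g L = g M" "L \<noteq> M"
    then have "orthogonal_squares n L M" using assms(1) unfolding mols_def pairwise_def by blast
    moreover have "g L < n" using g[OF LM(1)] by simp
    ultimately have "(1::nat, g L) = (0, 0)"
      using inj_onD[of "\<lambda>(i, j). (L $$ (i, j), M $$ (i, j))" "{..<n} \<times> {..<n}" "(1, g L)" "(0, 0)"]
        g[OF LM(1)] g[OF LM(2)] LM(3) assms(2)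
      by (simp add: orthogonal_squares_def)
    then show False by simp
  qed
  then have "card S \<le> card {1..<n}"
    by (rule card_inj_on_le) (use g in auto)
  then show ?thesis by simp
qed

end

theory Submission
  imports Defs "HOL-Number_Theory.Cong"
begin

text \<open>A difference matrix over \<open>\<int>/n\<close> with rows \<open>D\<^sub>0, \<dots>, D\<^sub>r\<close> gives the \<open>r\<close> mutually orthogonal
  squares \<open>L\<^sub>k(i, j) = i + D\<^sub>k(j) - D\<^sub>0(j)\<close>: the difference of two entries of the same cell
  determines its column \<open>j\<close>, and then one entry determines \<open>i\<close>. For \<open>n = 35\<close> there is such a matrix
  with 7 rows, whose columns are the cyclic shifts of 5 base columns.\<close>

definition difference_matrix :: "nat \<Rightarrow> nat \<Rightarrow> (nat \<Rightarrow> nat \<Rightarrow> int) \<Rightarrow> bool" where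
  "difference_matrix n r D \<longleftrightarrow>
     (\<forall>k<r. \<forall>l<k. inj_on (\<lambda>j. (D k j - D l j) mod int n) {..<n})"

text \<open>Subtracting row 0 replaces the assumption that this row is zero, which fails for
  \<open>dm35\<close>. Row 0 yields no square of its own, hence the shift to
  \<open>Suc k\<close>.\<close>

definition dm_square :: "nat \<Rightarrow> (nat \<Rightarrow> nat \<Rightarrow> int) \<Rightarrow> nat \<Rightarrow> nat mat" where
  "dm_square n D k = mat n n (\<lambda>(i, j). nat ((int i + (D (Suc k) j - D 0 j)) mod int n))"

text \<open>The definition ranges over pairs \<open>l < k\<close> only, which halves the final
  computation; negating the congruence gives the other order.\<close>

lemma difference_matrixD:
  assumes "difference_matrix n r D" "k < r" "l < r" "k \<noteq> l" "i < n" "j < n"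
    and "[D k i - D l i = D k j - D l j] (mod int n)"
  shows "i = j"
proof (cases "l < k")
  case True
  then have "inj_on (\<lambda>j. (D k j - D l j) mod int n) {..<n}"
    using assms(1,2) unfolding difference_matrix_def by blast
  then show ?thesis
    using assms(5-7) by (auto simp: cong_def dest: inj_onD)
next
  case False
  then have "inj_on (\<lambda>j. (D l j - D k j) mod int n) {..<n}"
    using assms(1,3,4) unfolding difference_matrix_def by (meson nat_neq_iff)
  moreover have "[D l i - D k i = D l j - D k j] (mod int n)"
    using cong_minus_minus_iff[THEN iffD2, OF assms(7)] by simp
  ultimately show ?thesis
    using assms(5,6) by (auto simp: cong_def dest: inj_onD)
qed

lemma dm_square_eq_iff:
  assumes "i < n" "j < n" "i' < n" "j' < n"
  shows "dm_square n D k $$ (i, j) = dm_square n D k $$ (i', j') \<longleftrightarrow>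
    [int i + (D (Suc k) j - D 0 j) = int i' + (D (Suc k) j' - D 0 j')] (mod int n)"
  using assms by (simp add: dm_square_def cong_def eq_nat_nat_iff)

lemma bij_betw_lessThan_nat:
  fixes f :: "nat \<Rightarrow> nat"
  assumes "inj_on f {..<n}" "\<And>i. i < n \<Longrightarrow> f i < n"
  shows "bij_betw f {..<n} {..<n}"
proof -
  have "f ` {..<n} \<subseteq> {..<n}"
    using assms(2) by auto
  then show ?thesis
    using endo_inj_surj[OF finite_lessThan _ assms(1)] assms(1) by (simp add: bij_betw_def)
qed

text \<open>Along a row \<open>i\<close> cancels, leaving the difference of matrix rows
  \<open>Suc k\<close> and 0; along a column the entry is a translate of \<open>i\<close>.\<close>

lemma latin_square_dm_square:
  assumes "difference_matrix n (Suc r) D" "k < r"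
  shows "latin_square n {..<n} (dm_square n D k)"
proof -
  have less: "dm_square n D k $$ (i, j) < n" if "i < n" "j < n" for i j
    using that by (simp add: dm_square_def nat_less_iff)
  have "inj_on (\<lambda>j. dm_square n D k $$ (i, j)) {..<n}" if "i < n" for i
  proof (rule inj_onI)
    fix j j' assume *: "j \<in> {..<n}" "j' \<in> {..<n}"
      "dm_square n D k $$ (i, j) = dm_square n D k $$ (i, j')"
    then have "[D (Suc k) j - D 0 j = D (Suc k) j' - D 0 j'] (mod int n)"
      using that by (simp add: dm_square_eq_iff cong_add_lcancel)
    then show "j = j'"
      using difference_matrixD[OF assms(1), of "Suc k" 0 j j'] assms(2) * by simp
  qed
  moreover have "inj_on (\<lambda>i. dm_square n D k $$ (i, j)) {..<n}" if "j < n" for j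
  proof (rule inj_onI)
    fix i i' assume *: "i \<in> {..<n}" "i' \<in> {..<n}"
      "dm_square n D k $$ (i, j) = dm_square n D k $$ (i', j)"
    then have "[int i = int i'] (mod int n)"
      using that by (simp add: dm_square_eq_iff cong_add_rcancel)
    then show "i = i'"
      using * by (simp add: cong_def)
  qed
  moreover have "dm_square n D k \<in> carrier_mat n n"
    by (simp add: dm_square_def)
  ultimately show ?thesis
    unfolding latin_square_def by (auto intro!: bij_betw_lessThan_nat less)
qed

lemma orthogonal_squares_dm_square:
  assumes "difference_matrix n (Suc r) D" "k < r" "l < r" "k \<noteq> l"
  shows "orthogonal_squares n (dm_square n D k) (dm_square n D l)"
  unfolding orthogonal_squares_def
proof (rule inj_onI, clarsimp)
  fix i j i' j'
  assume lt: "i < n" "j < n" "i' < n" "j' < n"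
    and eq: "dm_square n D k $$ (i, j) = dm_square n D k $$ (i', j')"
      "dm_square n D l $$ (i, j) = dm_square n D l $$ (i', j')"
  then have
    k: "[int i + (D (Suc k) j - D 0 j) = int i' + (D (Suc k) j' - D 0 j')] (mod int n)" and
    l: "[int i + (D (Suc l) j - D 0 j) = int i' + (D (Suc l) j' - D 0 j')] (mod int n)"
    by (simp_all add: dm_square_eq_iff)
  \<comment> \<open>Subtraction eliminates both \<open>i\<close> and row 0.\<close>
  have "[D (Suc k) j - D (Suc l) j = D (Suc k) j' - D (Suc l) j'] (mod int n)"
    using cong_diff[OF k l] by simp
  then have j: "j = j'"
    using difference_matrixD[OF assms(1), of "Suc k" "Suc l" j j'] assms(2-4) lt by simp
  then have "[int i = int i'] (mod int n)"
    using k by (simp add: cong_add_rcancel)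
  then show "i = i' \<and> j = j'"
    using j lt by (simp add: cong_def)
qed

lemma mols_difference_matrix:
  assumes "difference_matrix n (Suc r) D"
  shows "mols n (dm_square n D ` {..<r})"
  unfolding mols_def pairwise_def
  using latin_square_dm_square[OF assms] orthogonal_squares_dm_square[OF assms] by blast

text \<open>Equal squares would make two matrix rows congruent, so their difference would vanish in
  both columns 0 and 1; \<open>n \<ge> 2\<close> provides these two columns.\<close>

lemma card_mols_difference_matrix:
  assumes "difference_matrix n (Suc r) D" "n \<ge> 2"
  shows "card (dm_square n D ` {..<r}) = r"
proof -
  have "inj_on (dm_square n D) {..<r}"
  proof (rule inj_onI, rule ccontr)
    fix k l assume kl: "k \<in> {..<r}" "l \<in> {..<r}" "dm_square n D k = dm_square n D l" "k \<noteq> l"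
    have "[D (Suc k) j - D (Suc l) j = 0] (mod int n)" if "j < n" for j
    proof -
      have "dm_square n D k $$ (0, j) = dm_square n D l $$ (0, j)"
        using kl(3) by simp
      then have "[D (Suc k) j - D 0 j = D (Suc l) j - D 0 j] (mod int n)"
        using that assms(2) by (simp add: dm_square_def cong_def eq_nat_nat_iff)
      then show ?thesis
        by (simp add: cong_iff_dvd_diff)
    qed
    from this[of 0] this[of 1]
    have "[D (Suc k) 0 - D (Suc l) 0 = D (Suc k) 1 - D (Suc l) 1] (mod int n)"
      using assms(2) by (simp add: cong_def)
    then show False
      using difference_matrixD[OF assms(1), of "Suc k" "Suc l" 0 1] kl assms(2) by simp
  qed
  then show ?thesis
    by (simp add: card_image)
qed

text \<open>\<open>Max\<close> needs a finite set of cardinalities, which the bound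
  \<open>n - 1\<close> from \<open>card_mols_le\<close> ensures.\<close>

lemma max_mols_ge_card:
  fixes S :: "nat mat set"
  assumes "mols n S" "finite S" "n \<ge> 2"
  shows "card S \<le> max_mols n"
proof -
  have "{card S | S :: nat mat set. finite S \<and> mols n S} \<subseteq> {..n - 1}"
    using card_mols_le assms(3) by auto
  then have "finite {card S | S :: nat mat set. finite S \<and> mols n S}"
    by (rule finite_subset) simp
  then show ?thesis
    unfolding max_mols_def using assms(1,2) by (auto intro: Max_ge)
qed

text \<open>Found by a computer search among the matrices invariant under \<open>c \<mapsto> c'\<close>, where
  \<open>c'\<^sub>i = 16 c\<^sub>4\<^sub>i\<close> with indices modulo 7: this map fixes the first two base columns and permutes
  the other three cyclically. The symmetry leaves only the differences of adjacent entries
  to be matched with \<open>\<int>/35\<close>.\<close>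

definition base_columns :: "int list list" where
  "base_columns =
    [[0, 13, 33, 17, 3, 12, 27],
     [0, 26, 31, 34, 6, 24, 19],
     [0, 0, 1, 18, 30, 32, 29],
     [0, 25, 0, 22, 16, 9, 8],
     [0, 11, 15, 4, 0, 23, 2]]"

text \<open>Column \<open>j\<close> is base column \<open>j div 7\<close> shifted by
  \<open>j mod 7\<close>; reducing \<open>j + k\<close> modulo 7 performs the shift.\<close>

definition dm35 :: "nat \<Rightarrow> nat \<Rightarrow> int" where
  "dm35 k j = base_columns ! (j div 7) ! ((j + k) mod 7)"

lemma difference_matrix_dm35: "difference_matrix 35 7 dm35"
proof -
  \<comment> \<open>Quantifying over lists makes the condition executable: 21 pairs of rows with 35
    differences each.\<close>
  have "\<forall>k\<in>set [0..<7]. \<forall>l\<in>set [0..<k].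
      distinct (map (\<lambda>j. (dm35 k j - dm35 l j) mod 35) [0..<35])"
    by code_simp
  then show ?thesis
    by (simp add: difference_matrix_def distinct_map atLeast0LessThan)
qed

theorem theorem2:
  shows "max_mols 35 \<ge> 6 \<and> (\<exists>S :: nat mat set. mols 35 S \<and> card S = 6)"
proof -
  let ?S = "dm_square 35 dm35 ` {..<6}"
  have dm: "difference_matrix 35 (Suc 6) dm35"
    using difference_matrix_dm35 by simp
  have "mols 35 ?S" "card ?S = 6"
    using mols_difference_matrix[OF dm] card_mols_difference_matrix[OF dm] by simp_all
  then show ?thesis
    using max_mols_ge_card[of 35 ?S] by auto
qed

end
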